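(* Let $K\ge 1$ be an integer and let $a,b,c,d$ and $a_k,d_k,r_k$ ($1\le k\le K$) be arbitrary real numbers. Consider the $K+1$ real $2\times 2$ matrices $$A_0=\begin{bmatrix} a & b \\ c & d \end{bmatrix},\quad A_k=\begin{bmatrix} a_k & r_k b \\ {r_k} c & d_k \end{bmatrix}\quad (1\le k\le K).$$ If $bc>0$, then there exists a nonsingular matrix $Q\in\mathbb{R}^{2\times 2}$ such that the matrices $QA_kQ^{-1}$, $0\le k\le K$, are all symmetric.
   Context: A real square matrix $A=[a_{ij}]$ is symmetric if $a_{ij}=a_{ji}$ for all $i,j$. *)

theory Defs
  imports "HOL-Analysis.Analysis"
begin

definition symmetric_matrix :: "real ^ 'n ^ 'n \<Rightarrow> bool" where
  "symmetric_matrix A \<longleftrightarrow> (\<forall>i j. A $ i $ j = A $ j $ i)"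

end

theory Submission
  imports Defs
begin

text \<open>Conjugating by the diagonal matrix with entries 1 and t divides the upper right entry by t and
  multiplies the lower left entry by t, so it symmetrises every A k at once as soon as b = t * t * c.\<close>

text \<open>\<open>matrix_inv\<close> is a Hilbert choice; identifying it with an explicit matrix
  makes the entries of the conjugates computable.\<close>

lemma matrix_inv_eqI:
  fixes Q R :: "'a::semiring_1 ^ 'n ^ 'n"
  assumes "Q ** R = mat 1" and "R ** Q = mat 1"
  shows "matrix_inv Q = R"
proof -
  \<comment> \<open>\<open>R\<close> witnesses that the choice is not vacuous, so whatever is chosen
    is a left inverse of \<open>Q\<close>; reassociating then forces it to equal
    \<open>R\<close>.\<close>
  have "matrix_inv Q ** Q = mat 1"
    unfolding matrix_inv_def by (rule someI2[where a = R]) (simp_all add: assms)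
  then have "R = matrix_inv Q ** (Q ** R)"
    by (simp add: matrix_mul_assoc)
  with assms show ?thesis by simp
qed

text \<open>The product has diagonal entries \<open>p\<close>, \<open>q\<close> and off-diagonal
  entries \<open>x / t\<close> and \<open>t * y\<close>, which agree since \<open>x\<close> is
  \<open>t * t * y\<close>.\<close>

lemma symmetric_diagonal_conjugate:
  fixes t p q x y :: real
  assumes "t \<noteq> 0" and "x = t\<^sup>2 * y"
  shows "symmetric_matrix ((vector [vector [1, 0], vector [0, t]] :: real ^ 2 ^ 2)
    ** (vector [vector [p, x], vector [y, q]] :: real ^ 2 ^ 2)
    ** (vector [vector [1, 0], vector [0, 1 / t]] :: real ^ 2 ^ 2))"
  using assms
  by (simp add: symmetric_matrix_def matrix_matrix_mult_def sum_2 forall_2 power2_eq_square)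

theorem theorem1:
  fixes K :: nat
    and a b c d :: real
    and a' d' r :: "nat \<Rightarrow> real"
    and A :: "nat \<Rightarrow> real ^ 2 ^ 2"
  assumes "K \<ge> 1"
    and "A 0 = vector [vector [a, b], vector [c, d]]"
    and "\<And>k. 1 \<le> k \<Longrightarrow> k \<le> K \<Longrightarrow>
           A k = vector [vector [a' k, r k * b], vector [r k * c, d' k]]"
    and "b * c > 0"
  shows "\<exists>Q :: real ^ 2 ^ 2. invertible Q \<and>
           (\<forall>k\<le>K. symmetric_matrix (Q ** A k ** matrix_inv Q))"
proof -
  \<comment> \<open>The relation between \<open>b\<close> and \<open>c\<close> forces the square of
    \<open>t\<close> to be \<open>b / c\<close>, which is positive because \<open>b\<close> and
    \<open>c\<close> have the same sign.\<close>
  define t where "t = sqrt (b / c)"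
  from \<open>b * c > 0\<close> have "b / c > 0" and "c \<noteq> 0"
    by (auto simp: zero_less_mult_iff zero_less_divide_iff)
  then have "t \<noteq> 0" and b: "b = t\<^sup>2 * c"
    by (auto simp: t_def)
  define Q R :: "real ^ 2 ^ 2"
    where "Q = vector [vector [1, 0], vector [0, t]]"
      and "R = vector [vector [1, 0], vector [0, 1 / t]]"
  have "Q ** R = mat 1" and "R ** Q = mat 1"
    using \<open>t \<noteq> 0\<close>
    by (simp_all add: Q_def R_def matrix_matrix_mult_def mat_def vec_eq_iff sum_2 forall_2)
  then have "invertible Q" and inv: "matrix_inv Q = R"
    by (auto simp: invertible_def intro: matrix_inv_eqI)
  moreover have "symmetric_matrix (Q ** A k ** matrix_inv Q)" if "k \<le> K" for k
  proof (cases "k = 0")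
    case True
    show ?thesis
      unfolding True inv assms(2) unfolding Q_def R_def
      by (rule symmetric_diagonal_conjugate[OF \<open>t \<noteq> 0\<close> b])
  next
    case False
    \<comment> \<open>The relation is homogeneous in the off-diagonal pair, so one \<open>t\<close>
      serves every \<open>k\<close>, whatever the sign of \<open>r k\<close> and even if it is
      zero.\<close>
    have "r k * b = t\<^sup>2 * (r k * c)"
      by (simp add: b)
    moreover have "A k = vector [vector [a' k, r k * b], vector [r k * c, d' k]]"
      using False that by (intro assms(3)) auto
    ultimately show ?thesis
      unfolding inv unfolding Q_def R_def
      using symmetric_diagonal_conjugate[OF \<open>t \<noteq> 0\<close>] by metis
  qed
  ultimately show ?thesis by blast
qed

end
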